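(* Let $p$ be a prime number. Then each of the six groups $$\mathrm{Aut}\,\mathcal{A}_p(+,\cdot),\quad \mathrm{Aut}\,\mathcal{A}_p(+,\mathrm{XOR}),\quad \mathrm{Aut}\,\mathcal{A}_p(+,\mathrm{AND}),$$ $$\mathrm{Aut}\,\mathcal{A}_p(\cdot,\mathrm{XOR}),\quad \mathrm{Aut}\,\mathcal{A}_p(\cdot,\mathrm{AND}),\quad \mathrm{Aut}\,\mathcal{A}_p(\mathrm{XOR},\mathrm{AND})$$ is trivial, i.e. consists only of the identity map of $\mathbb{Z}_p$.
   Context: $\mathbb{Z}_p$ is the set of $p$-adic integers with its usual addition $+$ and multiplication $\cdot$; each $x\in\mathbb{Z}_p$ is written in canonical form $x=\sum_{k\ge 0}p^kx_k$ with $x_k\in\{0,\ldots,p-1\}$. On $\{0,\ldots,p-1\}$, $\oplus_p$ and $\odot_p$ denote addition and multiplication modulo $p$ (results taken as least nonnegative residues). The coordinate-wise logical operations on $\mathbb{Z}_p$ are $$x\,\mathrm{XOR}\,y=\sum_{k\ge 0}p^k(x_k\oplus_p y_k),\qquad x\,\mathrm{AND}\,y=\sum_{k\ge 0}p^k(x_k\odot_p y_k).$$ For binary operations $*_1,*_2$ on $\mathbb{Z}_p$, $\mathcal{A}_p( *_1,*_2)$ denotes the algebraic system with carrier $\mathbb{Z}_p$, the operations $*_1,*_2$, and the family of congruence relations modulo $p^k$ for all $k\ge 1$. An automorphism of $\mathcal{A}_p( *_1,*_2)$ is a bijective map $f:\mathbb{Z}_p\to\mathbb{Z}_p$ such that $f(x*_iy)=f(x)*_if(y)$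 for all $x,y\in\mathbb{Z}_p$ and $i=1,2$, and such that for every $k\ge 1$ and all $x,y\in\mathbb{Z}_p$, $x\equiv y\pmod{p^k}$ implies $f(x)\equiv f(y)\pmod{p^k}$. $\mathrm{Aut}\,\mathcal{A}_p( *_1,*_2)$ is the group of all automorphisms of $\mathcal{A}_p( *_1,*_2)$ under composition. *)

theory Defs
  imports "HOL-Algebra.Algebra" "HOL-Computational_Algebra.Primes"
begin

section \<open>The ring of p-adic integers\<close>

text \<open>The inverse limit of the rings of integers modulo p^n: a p-adic integer x is the compatible
  sequence of its least nonnegative residues, x n being the residue modulo p^n.\<close>

definition padic_ints :: "int \<Rightarrow> (nat \<Rightarrow> int) set" where
  "padic_ints p = {x. \<forall>n. x n \<in> {0..<p ^ n} \<and> x (Suc n) mod p ^ n = x n}"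

definition padic_of_int :: "int \<Rightarrow> int \<Rightarrow> nat \<Rightarrow> int" where
  "padic_of_int p a = (\<lambda>n. a mod p ^ n)"

definition padic_add :: "int \<Rightarrow> (nat \<Rightarrow> int) \<Rightarrow> (nat \<Rightarrow> int) \<Rightarrow> (nat \<Rightarrow> int)" where
  "padic_add p x y = (\<lambda>n. (x n + y n) mod p ^ n)"

definition padic_mult :: "int \<Rightarrow> (nat \<Rightarrow> int) \<Rightarrow> (nat \<Rightarrow> int) \<Rightarrow> (nat \<Rightarrow> int)" where
  "padic_mult p x y = (\<lambda>n. (x n * y n) mod p ^ n)"

definition Zp :: "int \<Rightarrow> (nat \<Rightarrow> int) ring" where
  "Zp p = \<lparr>carrier = padic_ints p, monoid.mult = padic_mult p, one = padic_of_int p 1,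
           ring.zero = padic_of_int p 0, ring.add = padic_add p\<rparr>"

definition padic_cong :: "int \<Rightarrow> nat \<Rightarrow> (nat \<Rightarrow> int) \<Rightarrow> (nat \<Rightarrow> int) \<Rightarrow> bool" where
  "padic_cong p k x y \<longleftrightarrow> padic_of_int p (p ^ k) divides\<^bsub>Zp p\<^esub> (x \<ominus>\<^bsub>Zp p\<^esub> y)"

section \<open>Canonical expansions and coordinate-wise operations\<close>

text \<open>As x (Suc k) is the sum of the first k+1 terms of the canonical expansion of x, the
  coefficient of p^k is its quotient by p^k; see \<open>padic_of_digits_digit\<close> and
  \<open>padic_digit_of_digits\<close> below.\<close>

definition padic_digit :: "int \<Rightarrow> (nat \<Rightarrow> int) \<Rightarrow> nat \<Rightarrow> int" where
  "padic_digit p x k = x (Suc k) div p ^ k"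

definition padic_of_digits :: "int \<Rightarrow> (nat \<Rightarrow> int) \<Rightarrow> (nat \<Rightarrow> int)" where
  "padic_of_digits p d = (\<lambda>n. \<Sum>k<n. p ^ k * d k)"

definition padic_XOR :: "int \<Rightarrow> (nat \<Rightarrow> int) \<Rightarrow> (nat \<Rightarrow> int) \<Rightarrow> (nat \<Rightarrow> int)" where
  "padic_XOR p x y = padic_of_digits p (\<lambda>k. (padic_digit p x k + padic_digit p y k) mod p)"

definition padic_AND :: "int \<Rightarrow> (nat \<Rightarrow> int) \<Rightarrow> (nat \<Rightarrow> int) \<Rightarrow> (nat \<Rightarrow> int)" where
  "padic_AND p x y = padic_of_digits p (\<lambda>k. (padic_digit p x k * padic_digit p y k) mod p)"

section \<open>Automorphism groups\<close>

text \<open>As everywhere in \<open>HOL-Algebra.Bij\<close>, self-maps of the carrier are represented by extensional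
  functions; the multiplication of \<open>BijGroup\<close> is composition.\<close>

definition padic_Aut ::
  "int \<Rightarrow> ((nat \<Rightarrow> int) \<Rightarrow> (nat \<Rightarrow> int) \<Rightarrow> (nat \<Rightarrow> int)) \<Rightarrow>
   ((nat \<Rightarrow> int) \<Rightarrow> (nat \<Rightarrow> int) \<Rightarrow> (nat \<Rightarrow> int)) \<Rightarrow> ((nat \<Rightarrow> int) \<Rightarrow> (nat \<Rightarrow> int)) monoid" where
  "padic_Aut p op1 op2 = BijGroup (padic_ints p)
     \<lparr>carrier := {f \<in> Bij (padic_ints p).
        (\<forall>x\<in>padic_ints p. \<forall>y\<in>padic_ints p. f (op1 x y) = op1 (f x) (f y)) \<and>
        (\<forall>x\<in>padic_ints p. \<forall>y\<in>padic_ints p. f (op2 x y) = op2 (f x) (f y)) \<and>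
        (\<forall>k\<ge>1. \<forall>x\<in>padic_ints p. \<forall>y\<in>padic_ints p.
           padic_cong p k x y \<longrightarrow> padic_cong p k (f x) (f y))}\<rparr>"

lemma trivial_group_padic_Aut_iff:
  "trivial_group (padic_Aut p op1 op2) \<longleftrightarrow>
     group (padic_Aut p op1 op2) \<and> carrier (padic_Aut p op1 op2) = {\<lambda>x\<in>padic_ints p. x}"
  by (simp add: trivial_group_def padic_Aut_def BijGroup_def)

section \<open>Basic properties\<close>

lemma padic_intsD:
  assumes "x \<in> padic_ints p"
  shows "0 \<le> x n" "x n < p ^ n" "x (Suc n) mod p ^ n = x n" "x n mod p ^ n = x n"
  using assms by (auto simp: padic_ints_def)

lemma padic_ints_mod:
  assumes "x \<in> padic_ints p" "m \<le> n"
  shows "x n mod p ^ m = x m"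
  using assms(2)
proof (induction n rule: dec_induct)
  case base
  show ?case using padic_intsD(4)[OF assms(1)] .
next
  case (step n)
  have "x (Suc n) mod p ^ m = (x (Suc n) mod p ^ n) mod p ^ m"
    using step(1) by (simp add: le_imp_power_dvd mod_mod_cancel)
  then show ?case using step padic_intsD(3)[OF assms(1)] by simp
qed

lemma padic_intsI:
  assumes "p > 1" "\<And>n. x n = y n mod p ^ n" "\<And>n. y (Suc n) mod p ^ n = y n mod p ^ n"
  shows "x \<in> padic_ints p"
  using assms by (auto simp: padic_ints_def mod_mod_cancel le_imp_power_dvd)

lemma padic_of_int_closed: "p > 1 \<Longrightarrow> padic_of_int p a \<in> padic_ints p"
  by (rule padic_intsI[where y = "\<lambda>_. a"]) (auto simp: padic_of_int_def)

lemma padic_add_closed: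
  assumes "p > 1" "x \<in> padic_ints p" "y \<in> padic_ints p"
  shows "padic_add p x y \<in> padic_ints p"
proof (rule padic_intsI[where y = "\<lambda>n. x n + y n"])
  fix n show "(x (Suc n) + y (Suc n)) mod p ^ n = (x n + y n) mod p ^ n"
    using padic_intsD(3)[OF assms(2)] padic_intsD(3)[OF assms(3)] by (metis mod_add_eq)
qed (use assms in \<open>auto simp: padic_add_def\<close>)

lemma padic_mult_closed:
  assumes "p > 1" "x \<in> padic_ints p" "y \<in> padic_ints p"
  shows "padic_mult p x y \<in> padic_ints p"
proof (rule padic_intsI[where y = "\<lambda>n. x n * y n"])
  fix n show "(x (Suc n) * y (Suc n)) mod p ^ n = (x n * y n) mod p ^ n"
    using padic_intsD(3)[OF assms(2)] padic_intsD(3)[OF assms(3)] by (metis mod_mult_eq)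
qed (use assms in \<open>auto simp: padic_mult_def\<close>)

lemma padic_neg_closed:
  assumes "p > 1" "x \<in> padic_ints p"
  shows "(\<lambda>n. (- x n) mod p ^ n) \<in> padic_ints p"
proof (rule padic_intsI[where y = "\<lambda>n. - x n"])
  fix n show "(- x (Suc n)) mod p ^ n = (- x n) mod p ^ n"
    using padic_intsD(3)[OF assms(2)] by (metis mod_minus_eq)
qed (use assms in auto)

lemma cring_Zp:
  assumes "p > 1"
  shows "cring (Zp p)"
proof (rule cringI)
  show "abelian_group (Zp p)"
  proof (rule abelian_groupI)
    fix x assume x: "x \<in> carrier (Zp p)"
    show "\<exists>y\<in>carrier (Zp p). y \<oplus>\<^bsub>Zp p\<^esub> x = \<zero>\<^bsub>Zp p\<^esub>"
      using padic_neg_closed[OF assms, of x] x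
      by (intro bexI[where x = "\<lambda>n. (- x n) mod p ^ n"])
         (auto simp: Zp_def padic_add_def padic_of_int_def mod_simps)
  qed (use assms in \<open>auto simp: Zp_def padic_add_closed padic_of_int_closed,
        auto simp: padic_add_def padic_of_int_def padic_intsD mod_simps add_ac\<close>)
  show "comm_monoid (Zp p)"
    by (rule comm_monoidI, use assms in \<open>auto simp: Zp_def padic_mult_closed padic_of_int_closed\<close>)
       (auto simp: padic_mult_def padic_of_int_def padic_intsD mod_simps mult_ac)
qed (auto simp: Zp_def padic_add_def padic_mult_def mod_simps algebra_simps)

lemma padic_cong_iff:
  assumes p: "p > 1" and x: "x \<in> padic_ints p" and y: "y \<in> padic_ints p"
  shows "padic_cong p k x y \<longleftrightarrow> x k = y k"
proof -
  interpret cring "Zp p" using p by (rule cring_Zp)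
  let ?q = "padic_of_int p (p ^ k)"
  have xc: "x \<in> carrier (Zp p)" and yc: "y \<in> carrier (Zp p)" and qc: "?q \<in> carrier (Zp p)"
    using x y p by (auto simp: Zp_def padic_of_int_closed)
  have "x \<ominus>\<^bsub>Zp p\<^esub> y = z \<longleftrightarrow> x = y \<oplus>\<^bsub>Zp p\<^esub> z" if "z \<in> carrier (Zp p)" for z
    using xc yc that by (metis a_minus_def a_comm a_inv_closed minus_closed r_neg1 r_neg2)
  then have 1: "padic_cong p k x y \<longleftrightarrow> (\<exists>c\<in>padic_ints p. x = padic_add p y (padic_mult p ?q c))"
    using qc m_closed[OF qc] unfolding padic_cong_def factor_def
    by (auto simp: Zp_def)
  show ?thesis
  proof
    assume "padic_cong p k x y"
    then show "x k = y k"
      using 1 padic_intsD(4)[OF y] by (auto simp: padic_add_def padic_mult_def padic_of_int_def)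
  next
    assume eq: "x k = y k"
    define d where "d n = (x (n + k) - y (n + k)) div p ^ k" for n
    have d: "x (n + k) - y (n + k) = p ^ k * d n" for n
    proof -
      have "(x (n + k) - y (n + k)) mod p ^ k = 0"
        using padic_ints_mod[OF x, of k "n + k"] padic_ints_mod[OF y, of k "n + k"] eq
        by (simp add: mod_diff_eq[symmetric])
      then show ?thesis unfolding d_def by (auto simp: mod_0_imp_dvd)
    qed
    let ?c = "\<lambda>n. d n mod p ^ n"
    have "?c \<in> padic_ints p"
    proof (rule padic_intsI[where y = d])
      fix n
      have "p ^ (n + k) dvd x (Suc (n + k)) - x (n + k)" 
        using padic_intsD(3)[OF x, of "n + k"] by (metis dvd_minus_mod)
      moreover have "p ^ (n + k) dvd y (Suc (n + k)) - y (n + k)"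
        using padic_intsD(3)[OF y, of "n + k"] by (metis dvd_minus_mod)
      moreover have "p ^ k * d (Suc n) - p ^ k * d n =
          (x (Suc (n + k)) - x (n + k)) - (y (Suc (n + k)) - y (n + k))"
        using d[of n] d[of "Suc n"] by simp
      ultimately have "p ^ (n + k) dvd p ^ k * d (Suc n) - p ^ k * d n"
        by (metis dvd_diff)
      then have "p ^ k * p ^ n dvd p ^ k * (d (Suc n) - d n)"
        by (simp add: power_add algebra_simps)
      then have "p ^ n dvd d (Suc n) - d n" using p by simp
      then show "d (Suc n) mod p ^ n = d n mod p ^ n" by (simp add: mod_eq_dvd_iff)
    qed (use p in auto)
    moreover have "x = padic_add p y (padic_mult p ?q ?c)"
    proof
      fix n
      have "padic_add p y (padic_mult p ?q ?c) n = (y n + p ^ k * d n) mod p ^ n"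
        by (simp add: padic_add_def padic_mult_def padic_of_int_def mod_simps)
      also have "\<dots> = (y (n + k) mod p ^ n + (x (n + k) - y (n + k))) mod p ^ n"
        using padic_ints_mod[OF y, of n "n + k"] d by simp
      also have "\<dots> = x n"
        using padic_ints_mod[OF x, of n "n + k"] by (simp add: mod_simps)
      finally show "x n = padic_add p y (padic_mult p ?q ?c) n" by simp
    qed
    ultimately show "padic_cong p k x y" using 1 by blast
  qed
qed

lemma padic_digit_range:
  assumes "p > 1" "x \<in> padic_ints p"
  shows "padic_digit p x k \<in> {0..<p}"
proof -
  have "0 < p ^ k" "0 \<le> x (Suc k)" "x (Suc k) < p * p ^ k"
    using assms(1) padic_intsD(1,2)[OF assms(2), of "Suc k"] by auto
  moreover have "x (Suc k) div p ^ k * p ^ k \<le> x (Suc k)"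
    using div_mult_mod_eq[of "x (Suc k)" "p ^ k"] pos_mod_sign[OF calculation(1), of "x (Suc k)"]
    by linarith
  ultimately have "x (Suc k) div p ^ k * p ^ k < p * p ^ k"
    by linarith
  then have "x (Suc k) div p ^ k < p"
    using \<open>0 < p ^ k\<close> mult_less_cancel_right_pos by blast
  moreover have "0 \<le> x (Suc k) div p ^ k"
    using \<open>0 < p ^ k\<close> \<open>0 \<le> x (Suc k)\<close> by (simp add: pos_imp_zdiv_nonneg_iff)
  ultimately show ?thesis
    by (simp add: padic_digit_def)
qed

lemma padic_of_digits_digit:
  assumes "x \<in> padic_ints p"
  shows "padic_of_digits p (padic_digit p x) = x"
proof
  fix n show "padic_of_digits p (padic_digit p x) n = x n"
  proof (induction n)
    case 0
    show ?case using padic_intsD(1,2)[OF assms, of 0] by (simp add: padic_of_digits_def)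
  next
    case (Suc n)
    then show ?case using padic_intsD(3)[OF assms, of n] mult_div_mod_eq[of "p ^ n" "x (Suc n)"]
      by (simp add: padic_of_digits_def padic_digit_def)
  qed
qed

lemma padic_of_digits_range:
  assumes "p > 1" "\<And>k. d k \<in> {0..<p}"
  shows "padic_of_digits p d n \<in> {0..<p ^ n}"
proof (induction n)
  case 0
  show ?case by (simp add: padic_of_digits_def)
next
  case (Suc n)
  have "0 \<le> p ^ n * d n" "p ^ n * d n \<le> p ^ n * (p - 1)"
    using assms(1) assms(2)[of n] by (auto intro!: mult_left_mono)
  then show ?case using Suc by (auto simp: padic_of_digits_def algebra_simps)
qed

lemma padic_of_digits_closed:
  assumes "p > 1" "\<And>k. d k \<in> {0..<p}"
  shows "padic_of_digits p d \<in> padic_ints p"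
  using padic_of_digits_range[OF assms]
  by (auto simp: padic_ints_def) (auto simp: padic_of_digits_def)

lemma padic_digit_of_digits:
  assumes "p > 1" "\<And>k. d k \<in> {0..<p}"
  shows "padic_digit p (padic_of_digits p d) k = d k"
  using padic_of_digits_range[OF assms, where n = k] assms(1)
  by (simp add: padic_digit_def padic_of_digits_def)

lemma padic_XOR_closed: "p > 1 \<Longrightarrow> padic_XOR p x y \<in> padic_ints p"
  unfolding padic_XOR_def by (rule padic_of_digits_closed) auto

lemma padic_AND_closed: "p > 1 \<Longrightarrow> padic_AND p x y \<in> padic_ints p"
  unfolding padic_AND_def by (rule padic_of_digits_closed) auto

end

theory Submission
  imports Defs
begin

text \<open>A bijection that respects all congruences is an isometry: on the finitely many residues
  modulo \<open>p ^ n\<close> it induces a surjective, hence injective, map (lemma \<open>cong_iff\<close>). In particular,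
  once \<open>f 0 = 0\<close> is known, the canonical expansion of \<open>f (p ^ n)\<close> starts exactly at position \<open>n\<close>.
  This rigidity is combined with what each single operation gives.

  \<^item> Addition: by density of the natural numbers \<open>f x = x * f 1\<close>, so it suffices that \<open>f 1 = 1\<close>.

  \<^item> AND: the powers of \<open>p\<close> are orthogonal idempotents. Their images are too, and their leading
  positions are the old ones, which forces \<open>f (p ^ n) = p ^ n\<close> (lemma \<open>AND_fixes_power\<close>).

  \<^item> XOR: the powers of \<open>p\<close> generate the natural numbers under XOR, so an \<open>f\<close> that preserves XOR
  and fixes the powers of \<open>p\<close> is the identity (lemma \<open>XOR_identity\<close>).

  \<^item> Multiplication: \<open>f 1 = 1\<close>, and \<open>f (-1) = -1\<close> because \<open>1\<close> and \<open>-1\<close> are the only square roots of \<open>1\<close>.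

  These facts settle multiplication or AND together with addition, and XOR together with AND.
  Three pairs need one more idea. For multiplication and XOR it is the identity
  \<open>-p = (-1) XOR 1\<close>, which shows that \<open>f\<close> fixes \<open>p\<close> and hence its powers. For addition and XOR it
  is the fact that a sum agrees with XOR exactly if no carry occurs. For multiplication and AND,
  \<open>f\<close> acts on every digit by one function \<open>\<phi>\<close>, and \<open>d * (p - 1) = (d - 1) * p + (p - d)\<close> turns
  multiplicativity into the recursion \<open>\<phi> (d - 1) = \<phi> d - 1\<close>.\<close>

section \<open>Digits and arithmetic of p-adic integers\<close>

lemma div_less_if_less_mult_int:
  fixes a b c :: int
  assumes "0 < b" "a < c * b"
  shows "a div b < c"
proof -
  have "a div b * b \<le> a"
    using assms(1) div_mult_mod_eq[of a b] pos_mod_sign[of b a] by linarith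
  then have "a div b * b < c * b"
    using assms(2) by linarith
  then show ?thesis
    using assms(1) mult_less_cancel_right_pos by blast
qed

locale padic_prime =
  fixes p :: int
  assumes prime: "Factorial_Ring.prime p"
begin

abbreviation Z :: "(nat \<Rightarrow> int) set" where "Z \<equiv> padic_ints p"
abbreviation num :: "int \<Rightarrow> nat \<Rightarrow> int" where "num \<equiv> padic_of_int p"
abbreviation dig :: "(nat \<Rightarrow> int) \<Rightarrow> nat \<Rightarrow> int" where "dig \<equiv> padic_digit p"

lemma p_gt_1: "p > 1"
  using prime by (simp add: prime_gt_1_int)

lemmas num_closed [simp] = padic_of_int_closed[OF p_gt_1]
lemmas mult_closed [simp] = padic_mult_closed[OF p_gt_1]
lemmas XOR_closed [simp] = padic_XOR_closed[OF p_gt_1]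
lemmas AND_closed [simp] = padic_AND_closed[OF p_gt_1]

lemma dig_bounds:
  assumes "x \<in> Z"
  shows "0 \<le> dig x k" "dig x k < p"
  using padic_digit_range[OF p_gt_1 assms, of k] by auto

lemma dig_mod [simp]: "x \<in> Z \<Longrightarrow> dig x k mod p = dig x k"
  using dig_bounds[of x k] by simp

lemma dig_XOR [simp]: "dig (padic_XOR p x y) k = (dig x k + dig y k) mod p"
  unfolding padic_XOR_def using p_gt_1 by (subst padic_digit_of_digits) auto

lemma dig_AND [simp]: "dig (padic_AND p x y) k = (dig x k * dig y k) mod p"
  unfolding padic_AND_def using p_gt_1 by (subst padic_digit_of_digits) auto

lemma dig_eqI: "x \<in> Z \<Longrightarrow> y \<in> Z \<Longrightarrow> (\<And>k. dig x k = dig y k) \<Longrightarrow> x = y"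
  by (metis padic_of_digits_digit ext)

lemma residue_eq_sum_dig: "x \<in> Z \<Longrightarrow> x n = (\<Sum>k<n. p ^ k * dig x k)"
  by (metis padic_of_digits_def padic_of_digits_digit)

lemma residue_Suc: "x \<in> Z \<Longrightarrow> x (Suc n) = x n + p ^ n * dig x n"
  by (simp add: residue_eq_sum_dig)

lemma num_single_digit:
  assumes "0 \<le> d" "d < p"
  shows "num (d * p ^ n) = padic_of_digits p (\<lambda>k. if k = n then d else 0)"
proof
  fix N
  have "d * p ^ n mod p ^ N = (if n < N then d * p ^ n else 0)"
  proof (cases "n < N")
    case True
    have "d * p ^ n < p * p ^ n"
      using assms p_gt_1 by simp
    also have "p * p ^ n \<le> p ^ N"
      using True p_gt_1 by (metis Suc_leI int_one_le_iff_zero_less less_imp_le power_Suc power_increasing zero_less_one)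
    finally show ?thesis
      using True assms p_gt_1 by simp
  qed (simp add: le_imp_power_dvd)
  then show "num (d * p ^ n) N = padic_of_digits p (\<lambda>k. if k = n then d else 0) N"
    by (simp add: padic_of_int_def padic_of_digits_def if_distrib sum.delta mult.commute cong: if_cong)
qed

lemma dig_num_single:
  assumes "0 \<le> d" "d < p"
  shows "dig (num (d * p ^ n)) k = (if k = n then d else 0)"
  unfolding num_single_digit[OF assms] using assms p_gt_1
  by (subst padic_digit_of_digits) auto

lemma dig_num_power [simp]: "dig (num (p ^ n)) k = (if k = n then 1 else 0)"
  using dig_num_single[of 1 n k] p_gt_1 by simp

lemma dig_num_digit: "0 \<le> d \<Longrightarrow> d < p \<Longrightarrow> dig (num d) k = (if k = 0 then d else 0)"
  using dig_num_single[of d 0 k] by simp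

lemma num_0_residue: "num 0 n = 0"
  by (simp add: padic_of_int_def)

lemma dig_num_0 [simp]: "dig (num 0) k = 0"
  using dig_num_digit[of 0 k] p_gt_1 by simp

lemma dig_num_1 [simp]: "dig (num 1) k = (if k = 0 then 1 else 0)"
  using dig_num_digit[of 1 k] p_gt_1 by simp

lemma dig_num_minus_1 [simp]: "dig (num (-1)) k = p - 1"
proof -
  have "(-1) mod p ^ Suc k = p ^ Suc k - 1"
    using p_gt_1 by (metis one_less_power zero_less_Suc zmod_minus1 less_trans zero_less_one)
  also have "\<dots> = (p ^ k - 1) + p ^ k * (p - 1)"
    by (simp add: algebra_simps)
  finally show ?thesis
    using p_gt_1 by (simp add: padic_digit_def padic_of_int_def)
qed

lemma dig_num_eq_0:
  assumes "0 \<le> r" "r < p ^ n" "n \<le> k"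
  shows "dig (num r) k = 0"
proof -
  have "p ^ n \<le> p ^ k" "p ^ k \<le> p ^ Suc k"
    using assms p_gt_1 by (auto intro!: power_increasing)
  then have "r < p ^ k" "r < p ^ Suc k"
    using assms by linarith+
  then show ?thesis
    using assms by (simp add: padic_digit_def padic_of_int_def)
qed

lemma AND_num_power:
  assumes "x \<in> Z"
  shows "padic_AND p x (num (p ^ n)) = num (dig x n * p ^ n)"
  using assms dig_bounds[OF assms, of n] by (intro dig_eqI) (auto simp: dig_num_single)

lemma num_add: "padic_add p (num a) (num b) = num (a + b)"
  by (auto simp: padic_add_def padic_of_int_def mod_simps)

lemma num_mult: "padic_mult p (num a) (num b) = num (a * b)"
  by (auto simp: padic_mult_def padic_of_int_def mod_simps)

lemma mult_num_1 [simp]: "x \<in> Z \<Longrightarrow> padic_mult p x (num 1) = x"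
  by (auto simp: padic_mult_def padic_of_int_def mod_simps padic_intsD(4))

lemma mult_num_0 [simp]: "padic_mult p x (num 0) = num 0"
  by (auto simp: padic_mult_def padic_of_int_def)

lemma mult_commute: "padic_mult p x y = padic_mult p y x"
  by (simp add: padic_mult_def mult.commute)

text \<open>Cancelling \<open>p\<close> modulo \<open>p ^ (n + 1)\<close> gives equality modulo \<open>p ^ n\<close> only; as this holds for every \<open>n\<close>,
  nothing is lost.\<close>

lemma mult_num_p_cancel:
  assumes "x \<in> Z" "y \<in> Z" "padic_mult p (num p) x = padic_mult p (num p) y"
  shows "x = y"
proof
  fix n
  have "p * x (Suc n) mod p ^ Suc n = p * y (Suc n) mod p ^ Suc n"
    using fun_cong[OF assms(3), of "Suc n"] by (simp add: padic_mult_def padic_of_int_def mod_simps)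
  then have "x (Suc n) mod p ^ n = y (Suc n) mod p ^ n"
    using p_gt_1 by (simp add: mult_mod_right[symmetric])
  then show "x n = y n"
    using assms padic_intsD(3) by metis
qed

lemma power_dvd_mult_cases:
  assumes "p ^ (m + n) dvd a * b"
  shows "p ^ m dvd a \<or> p ^ n dvd b"
  using assms
proof (induction m arbitrary: a)
  case (Suc m)
  show ?case
  proof (cases "p dvd a")
    case True
    then obtain c where c: "a = p * c" by blast
    then have "p ^ (m + n) dvd c * b"
      using Suc.prems p_gt_1 by (simp add: mult.assoc)
    then show ?thesis using Suc.IH[of c] c by auto
  next
    case False
    then have "coprime (p ^ (Suc m + n)) a"
      using prime by (simp add: prime_imp_coprime)
    then have "p ^ (Suc m + n) dvd b"
      using Suc.prems coprime_dvd_mult_right_iff by blast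
    then show ?thesis
      by (metis dvd_trans le_add2 le_imp_power_dvd)
  qed
qed simp

text \<open>The \<open>p\<close>-adic integers have no zero divisors: if \<open>y\<close> differed from \<open>1\<close> modulo \<open>p ^ m\<close> and from \<open>-1\<close>
  modulo \<open>p ^ n\<close>, then \<open>(y - 1) * (y + 1)\<close> would not vanish modulo \<open>p ^ (m + n)\<close>. The argument covers
  \<open>p = 2\<close> as well, where \<open>1\<close> has more than two square roots modulo powers of \<open>2\<close>.\<close>

lemma square_eq_1:
  assumes y: "y \<in> Z" and sq: "padic_mult p y y = num 1"
  shows "y = num 1 \<or> y = num (-1)"
proof (rule ccontr)
  assume "\<not> ?thesis"
  then obtain m n where m: "y m \<noteq> num 1 m" and n: "y n \<noteq> num (-1) n"
    by (auto simp: fun_eq_iff)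
  \<comment> \<open>Both incongruences are read off from the single residue at \<open>m + n\<close>.\<close>
  have red: "y i = y (m + n) mod p ^ i" if "i \<le> m + n" for i
    using padic_ints_mod[OF y that] by simp
  have "(y (m + n) * y (m + n)) mod p ^ (m + n) = 1 mod p ^ (m + n)"
    using fun_cong[OF sq, of "m + n"] by (simp add: padic_mult_def padic_of_int_def)
  then have "p ^ (m + n) dvd (y (m + n) - 1) * (y (m + n) - (-1))"
    by (simp add: mod_eq_dvd_iff algebra_simps)
  then have "p ^ m dvd y (m + n) - 1 \<or> p ^ n dvd y (m + n) - (-1)"
    by (rule power_dvd_mult_cases)
  then show False
    using m n red[of m] red[of n] by (simp only: mod_eq_dvd_iff[symmetric] padic_of_int_def) auto
qed

section \<open>Carries\<close>

definition carry :: "(nat \<Rightarrow> int) \<Rightarrow> (nat \<Rightarrow> int) \<Rightarrow> nat \<Rightarrow> int" where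
  "carry x y = padic_of_digits p (\<lambda>k. (dig x k + dig y k) div p)"

lemma carry_digit_range:
  assumes "x \<in> Z" "y \<in> Z"
  shows "(dig x k + dig y k) div p \<in> {0..1}"
proof -
  have "0 \<le> dig x k + dig y k" "dig x k + dig y k < 2 * p"
    using dig_bounds[OF assms(1), of k] dig_bounds[OF assms(2), of k] by auto
  then show ?thesis
    using p_gt_1 div_less_if_less_mult_int[of p "dig x k + dig y k" 2]
    by (auto simp: pos_imp_zdiv_nonneg_iff)
qed

lemma carry_closed [simp]: "x \<in> Z \<Longrightarrow> y \<in> Z \<Longrightarrow> carry x y \<in> Z"
  unfolding carry_def using carry_digit_range[of x y] p_gt_1
  by (intro padic_of_digits_closed) (simp_all, smt (verit))

lemma dig_carry: "x \<in> Z \<Longrightarrow> y \<in> Z \<Longrightarrow> dig (carry x y) k = (dig x k + dig y k) div p"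
  unfolding carry_def using carry_digit_range[of x y] p_gt_1
  by (intro padic_digit_of_digits) (simp_all, smt (verit))

lemma add_eq_XOR_plus_carry:
  assumes "x \<in> Z" "y \<in> Z"
  shows "padic_add p x y = padic_add p (padic_XOR p x y) (padic_mult p (num p) (carry x y))"
proof
  fix n
  have "x n + y n = (\<Sum>k<n. p ^ k * (dig x k + dig y k))"
    using assms by (simp add: residue_eq_sum_dig sum.distrib algebra_simps)
  also have "\<dots> = (\<Sum>k<n. p ^ k * ((dig x k + dig y k) mod p) + p * (p ^ k * ((dig x k + dig y k) div p)))"
  proof (rule sum.cong)
    fix k
    show "p ^ k * (dig x k + dig y k) = p ^ k * ((dig x k + dig y k) mod p) + p * (p ^ k * ((dig x k + dig y k) div p))"
      by (subst mult_div_mod_eq[of p "dig x k + dig y k", symmetric]) (simp only: algebra_simps)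
  qed simp
  also have "\<dots> = padic_XOR p x y n + p * carry x y n"
    by (simp add: padic_XOR_def carry_def padic_of_digits_def sum.distrib sum_distrib_left)
  finally show "padic_add p x y n = padic_add p (padic_XOR p x y) (padic_mult p (num p) (carry x y)) n"
    by (simp add: padic_add_def padic_mult_def padic_of_int_def mod_simps)
qed

lemma add_num_0_right [simp]: "x \<in> Z \<Longrightarrow> padic_add p x (num 0) = x"
  by (auto simp: padic_add_def padic_of_int_def padic_intsD(4))

lemma add_num_0_left [simp]: "x \<in> Z \<Longrightarrow> padic_add p (num 0) x = x"
  by (auto simp: padic_add_def padic_of_int_def padic_intsD(4))

text \<open>The sum exceeds XOR by \<open>p\<close> times the number formed by the carries \<open>(x\<^sub>k + y\<^sub>k) div p\<close>, and this
  number is zero only if every carry is.\<close>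

lemma XOR_eq_add_iff:
  assumes x: "x \<in> Z" and y: "y \<in> Z"
  shows "padic_XOR p x y = padic_add p x y \<longleftrightarrow> (\<forall>k. dig x k + dig y k < p)"
proof -
  have no_carry: "(dig x k + dig y k) div p = 0 \<longleftrightarrow> dig x k + dig y k < p" for k
    using dig_bounds[OF x, of k] dig_bounds[OF y, of k] p_gt_1
    by (auto simp: zdiv_eq_0_iff)
  have "carry x y = num 0 \<longleftrightarrow> (\<forall>k. dig x k + dig y k < p)"
  proof
    assume "carry x y = num 0"
    then show "\<forall>k. dig x k + dig y k < p"
      using dig_carry[OF x y] no_carry by simp
  next
    assume "\<forall>k. dig x k + dig y k < p"
    then show "carry x y = num 0"
      using x y no_carry by (intro dig_eqI) (auto simp: dig_carry)
  qed
  moreover have "padic_XOR p x y = padic_add p x y \<longleftrightarrow> carry x y = num 0"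
  proof
    assume "carry x y = num 0"
    then show "padic_XOR p x y = padic_add p x y"
      using add_eq_XOR_plus_carry[OF x y] by simp
  next
    assume eq: "padic_XOR p x y = padic_add p x y"
    let ?c = "padic_mult p (num p) (carry x y)"
    have "?c n = 0" for n
    proof -
      have "padic_XOR p x y n = (padic_XOR p x y n + ?c n) mod p ^ n"
        using fun_cong[OF add_eq_XOR_plus_carry[OF x y], of n] eq by (simp add: padic_add_def)
      then have "p ^ n dvd ?c n"
        using padic_intsD(4)[OF XOR_closed, of x y n]
        by (metis add_diff_cancel_left' mod_eq_dvd_iff)
      then show ?thesis
        using padic_intsD(4)[OF mult_closed[OF num_closed carry_closed[OF x y]], of p n] by auto
    qed
    then have "?c = padic_mult p (num p) (num 0)"
      by (intro ext) (simp add: num_0_residue)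
    then show "carry x y = num 0"
      by (rule mult_num_p_cancel[OF carry_closed[OF x y] num_closed])
  qed
  ultimately show ?thesis by simp
qed

end

section \<open>Congruence-preserving bijections\<close>

locale padic_bijection = padic_prime +
  fixes f :: "(nat \<Rightarrow> int) \<Rightarrow> nat \<Rightarrow> int"
  assumes bij: "bij_betw f (padic_ints p) (padic_ints p)"
    and cong: "x \<in> padic_ints p \<Longrightarrow> y \<in> padic_ints p \<Longrightarrow> x k = y k \<Longrightarrow> f x k = f y k"
begin

abbreviation preserves :: "((nat \<Rightarrow> int) \<Rightarrow> (nat \<Rightarrow> int) \<Rightarrow> nat \<Rightarrow> int) \<Rightarrow> bool" where
  "preserves op \<equiv> \<forall>x\<in>Z. \<forall>y\<in>Z. f (op x y) = op (f x) (f y)"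

lemma closed [simp]: "x \<in> Z \<Longrightarrow> f x \<in> Z"
  using bij by (auto simp: bij_betw_def)

lemma surjE:
  assumes "y \<in> Z"
  obtains x where "x \<in> Z" "f x = y"
  using assms bij_betw_imp_surj_on[OF bij] by (metis imageE)

lemma inj: "x \<in> Z \<Longrightarrow> y \<in> Z \<Longrightarrow> f x = f y \<Longrightarrow> x = y"
  using bij by (auto simp: bij_betw_def inj_on_def)

lemma residue_num:
  assumes "x \<in> Z"
  shows "f x n = f (num (x n)) n"
  using assms by (intro cong) (simp_all, simp add: padic_of_int_def padic_intsD(4))

text \<open>On residues modulo \<open>p ^ n\<close> the map \<open>f\<close> induces a surjection of a finite set, which is therefore
  injective.\<close>

lemma cong_iff:
  assumes x: "x \<in> Z" and y: "y \<in> Z"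
  shows "f x n = f y n \<longleftrightarrow> x n = y n"
proof
  assume eq: "f x n = f y n"
  define g where "g r = f (num r) n" for r
  have "g ` {0..<p ^ n} = {0..<p ^ n}"
  proof
    show "g ` {0..<p ^ n} \<subseteq> {0..<p ^ n}"
      using padic_intsD(1,2)[OF closed[OF num_closed]] by (auto simp: g_def)
    show "{0..<p ^ n} \<subseteq> g ` {0..<p ^ n}"
    proof
      fix s assume s: "s \<in> {0..<p ^ n}"
      obtain z where z: "z \<in> Z" "f z = num s"
        using surjE num_closed by blast
      have "g (z n) = s"
        using residue_num[OF z(1), of n] z(2) s by (simp add: g_def padic_of_int_def)
      then show "s \<in> g ` {0..<p ^ n}"
        using padic_intsD(1,2)[OF z(1), of n] by force
    qed
  qed
  then have "inj_on g {0..<p ^ n}"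
    by (intro finite_surj_inj) auto
  moreover have "g (x n) = g (y n)"
    using eq residue_num[OF x, of n] residue_num[OF y, of n] by (simp add: g_def)
  ultimately show "x n = y n"
    using padic_intsD(1,2)[OF x, of n] padic_intsD(1,2)[OF y, of n] by (auto dest: inj_onD)
qed (use x y cong in blast)

text \<open>If the digit vanished, \<open>f (p ^ n)\<close> would be congruent to \<open>f 0\<close> modulo \<open>p ^ (n + 1)\<close>, although
  \<open>p ^ n\<close> is not congruent to \<open>0\<close>.\<close>

lemma dig_image_power:
  assumes "f (num 0) = num 0"
  shows "dig (f (num (p ^ n))) n \<noteq> 0"
proof
  let ?u = "f (num (p ^ n))"
  assume "dig ?u n = 0"
  moreover have "?u n = f (num 0) n"
    by (intro cong) (simp_all, simp add: padic_of_int_def)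
  ultimately have "?u (Suc n) = f (num 0) (Suc n)"
    using assms by (simp add: residue_Suc num_0_residue)
  then have "num (p ^ n) (Suc n) = num 0 (Suc n)"
    by (simp add: cong_iff)
  then show False
    using p_gt_1 by (simp add: padic_of_int_def)
qed

lemma identity_if_fixes_num:
  assumes "\<And>r. 0 \<le> r \<Longrightarrow> f (num r) = num r" "x \<in> Z"
  shows "f x = x"
proof
  fix n
  show "f x n = x n"
    using residue_num[OF assms(2), of n] assms(1)[of "x n"] padic_intsD(1,4)[OF assms(2), of n]
    by (simp add: padic_of_int_def)
qed

subsection \<open>Additive maps\<close>

lemma additive_0:
  assumes add: "preserves (padic_add p)"
  shows "f (num 0) = num 0"
proof
  fix n
  let ?z = "f (num 0)"
  have "padic_add p ?z ?z n = ?z n"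
    using add[rule_format, of "num 0" "num 0"] by (simp add: num_add)
  then have "(?z n + ?z n) mod p ^ n = ?z n mod p ^ n"
    by (simp add: padic_add_def padic_intsD(4))
  then have "?z n mod p ^ n = 0"
    unfolding mod_eq_dvd_iff by simp
  then show "?z n = num 0 n"
    by (simp add: padic_intsD(4) num_0_residue)
qed

text \<open>By induction the equation holds for natural numbers, and modulo \<open>p ^ n\<close> every \<open>x\<close> is one.\<close>

lemma additive_linear:
  assumes add: "preserves (padic_add p)" and x: "x \<in> Z"
  shows "f x = padic_mult p x (f (num 1))"
proof
  have nat: "f (num (int r)) = padic_mult p (num (int r)) (f (num 1))" for r
  proof (induction r)
    case 0
    show ?case using additive_0[OF add] by (simp add: mult_commute[of "num 0"])
  next
    case (Suc r)
    have "f (num (int (Suc r))) = padic_add p (f (num (int r))) (f (num 1))"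
      using add num_add[of "int r" 1] by (metis num_closed of_nat_Suc add.commute)
    then show ?case
      using Suc.IH by (auto simp: padic_add_def padic_mult_def padic_of_int_def mod_simps algebra_simps)
  qed
  fix n
  have "f x n = padic_mult p (num (x n)) (f (num 1)) n"
    using residue_num[OF x, of n] nat[of "nat (x n)"] padic_intsD(1)[OF x, of n] by simp
  then show "f x n = padic_mult p x (f (num 1)) n"
    by (simp add: padic_mult_def padic_of_int_def mod_simps)
qed

lemma additive_identity:
  assumes "preserves (padic_add p)" "f (num 1) = num 1" "x \<in> Z"
  shows "f x = x"
  using additive_linear[OF assms(1,3)] assms(2,3) by simp

text \<open>Let \<open>a = f 1\<close> and \<open>b = f (p - 1)\<close>. As \<open>(p - 1) XOR 1 = 0\<close> but \<open>(p - 1) + 1 = p\<close>, the number \<open>p * a\<close>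
  consists of the carries of \<open>b + a\<close> alone. Hence the digits of \<open>a\<close> are themselves carries: they lie
  in \<open>{0, 1}\<close>, and a digit \<open>1\<close> of \<open>a\<close> forces a digit \<open>p - 1\<close> of \<open>b\<close>. At a position \<open>m > 0\<close> the latter
  is impossible, because \<open>(p - 1) + p ^ m\<close> is free of carries and so is its image, while the
  image of \<open>p ^ m\<close> has a nonzero digit there.\<close>

lemma additive_XOR_unit:
  assumes add: "preserves (padic_add p)" and XOR: "preserves (padic_XOR p)"
  shows "f (num 1) = num 1"
proof -
  note f0 = additive_0[OF add]
  define a where "a = f (num 1)"
  define b where "b = f (num (p - 1))"
  have ab [simp]: "a \<in> Z" "b \<in> Z" by (simp_all add: a_def b_def)
  have "padic_XOR p (num (p - 1)) (num 1) = num 0"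
    using p_gt_1 by (intro dig_eqI) (auto simp: dig_num_digit)
  then have "padic_XOR p b a = num 0"
    using XOR f0 by (metis a_def b_def num_closed)
  moreover have "padic_add p b a = padic_mult p (num p) a"
  proof -
    have "padic_add p b a = f (num p)"
      using add num_add[of "p - 1" 1] by (simp add: a_def b_def flip: add)
    then show ?thesis
      using additive_linear[OF add, of "num p"] by (simp add: a_def)
  qed
  ultimately have "padic_mult p (num p) a = padic_mult p (num p) (carry b a)"
    using add_eq_XOR_plus_carry[of b a] by simp
  then have "a = carry b a"
    by (rule mult_num_p_cancel[rotated 2]) simp_all
  then have dig_a: "dig a k = (dig b k + dig a k) div p" for k
    using dig_carry[of b a k] by simp
  have dig_a_range: "dig a k \<in> {0..1}" for k
    using carry_digit_range[of b a k] dig_a[of k] by simp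
  have "dig a m = 0" if "m > 0" for m
  proof (rule ccontr)
    assume "dig a m \<noteq> 0"
    then have "dig a m = 1" using dig_a_range[of m] by auto
    then have b: "dig b m \<ge> p - 1"
      using dig_a[of m] p_gt_1 by (smt (verit) ab dig_bounds div_pos_pos_trivial)
    have "dig (num (p - 1)) k + dig (num (p ^ m)) k < p" for k
      using that p_gt_1 by (simp add: dig_num_digit)
    then have "padic_XOR p (num (p - 1)) (num (p ^ m)) = padic_add p (num (p - 1)) (num (p ^ m))"
      by (simp add: XOR_eq_add_iff)
    then have "padic_XOR p b (f (num (p ^ m))) = padic_add p b (f (num (p ^ m)))"
      using add XOR by (metis b_def num_closed)
    then have "dig b m + dig (f (num (p ^ m))) m < p"
      by (simp add: XOR_eq_add_iff)
    then show False
      using b dig_image_power[OF f0, of m] dig_bounds[of "f (num (p ^ m))" m] by simp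
  qed
  moreover have "dig a 0 = 1"
    using dig_a_range[of 0] dig_image_power[OF f0, of 0] by (auto simp: a_def)
  ultimately have "a = num 1"
    by (intro dig_eqI) auto
  then show ?thesis by (simp add: a_def)
qed

subsection \<open>Maps preserving the coordinate-wise operations\<close>

text \<open>Write \<open>u\<^sub>m\<close> for \<open>f (p ^ m)\<close>. At position \<open>n\<close> the digit of \<open>u\<^sub>n\<close> is nonzero. As \<open>u\<^sub>m AND u\<^sub>n = 0\<close> for
  \<open>m \<noteq> n\<close>, the digit of \<open>u\<^sub>m\<close> at position \<open>n\<close> vanishes, and as \<open>u\<^sub>m\<close> is idempotent, its remaining digit
  is \<open>1\<close>.\<close>

lemma AND_fixes_power:
  assumes AND: "preserves (padic_AND p)"
  shows "f (num 0) = num 0" and "f (num (p ^ m)) = num (p ^ m)"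
proof -
  have AND_0: "padic_AND p (num 0) x = num 0" "padic_AND p x (num 0) = num 0" for x
    by (auto intro!: dig_eqI)
  obtain z where "z \<in> Z" "f z = num 0"
    using surjE num_closed by blast
  then show f0: "f (num 0) = num 0"
    using AND AND_0 by (metis num_closed)
  show "f (num (p ^ m)) = num (p ^ m)"
  proof (rule dig_eqI)
    fix n
    let ?u = "\<lambda>i. dig (f (num (p ^ i))) n"
    have u: "0 \<le> ?u i" "?u i < p" for i
      by (simp_all add: dig_bounds)
    have nz: "\<not> p dvd ?u n"
      using u[of n] dig_image_power[OF f0, of n] by (simp add: zdvd_not_zless)
    show "?u m = dig (num (p ^ m)) n"
    proof (cases "n = m")
      case True
      have "padic_AND p (num (p ^ m)) (num (p ^ m)) = num (p ^ m)"
        using p_gt_1 by (intro dig_eqI) auto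
      then have "padic_AND p (f (num (p ^ m))) (f (num (p ^ m))) = f (num (p ^ m))"
        using AND by (metis num_closed)
      then have "(?u m * ?u m) mod p = ?u m mod p"
        using dig_AND[of "f (num (p ^ m))" "f (num (p ^ m))" n] by simp
      then have "p dvd ?u m * (?u m - 1)"
        unfolding mod_eq_dvd_iff by (simp add: algebra_simps)
      then have "p dvd ?u m - 1"
        using nz True prime by (auto simp: prime_dvd_mult_iff)
      moreover have "?u m \<ge> 1"
        using u[of m] nz True by (cases "?u m = 0") auto
      ultimately have "?u m = 1"
        using u[of m] zdvd_not_zless[of "?u m - 1" p] by force
      then show ?thesis using True by simp
    next
      case False
      have "padic_AND p (num (p ^ m)) (num (p ^ n)) = num 0"
        using False by (intro dig_eqI) auto
      then have "padic_AND p (f (num (p ^ m))) (f (num (p ^ n))) = num 0"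
        using AND f0 by (metis num_closed)
      then have "(?u m * ?u n) mod p = 0"
        using dig_AND[of "f (num (p ^ m))" "f (num (p ^ n))" n] by simp
      then have "p dvd ?u m"
        using nz prime by (auto simp: prime_dvd_mult_iff mod_eq_0_iff_dvd)
      then have "?u m = 0"
        using u[of m] zdvd_not_zless[of "?u m" p] by force
      then show ?thesis using False by simp
    qed
  qed simp_all
qed

text \<open>A digit \<open>d\<close> at position \<open>n\<close> is the \<open>d\<close>-fold XOR of \<open>p ^ n\<close>, and a natural number is the XOR of its
  digits. So \<open>f\<close> fixes the natural numbers, which are dense.\<close>

lemma XOR_identity:
  assumes XOR: "preserves (padic_XOR p)"
    and fixed: "\<And>n. f (num (p ^ n)) = num (p ^ n)" and x: "x \<in> Z"
  shows "f x = x"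
proof -
  have XOR_add: "padic_XOR p (num a) (num b) = num (a + b)"
    if "\<And>k. dig (num a) k + dig (num b) k < p" for a b
    using that by (simp add: XOR_eq_add_iff[THEN iffD2] num_add)
  \<comment> \<open>As \<open>0 XOR 0 = 0\<close>, each digit \<open>z\<close> of \<open>f 0\<close> satisfies \<open>z + z = z\<close> modulo \<open>p\<close>.\<close>
  have "padic_XOR p (f (num 0)) (f (num 0)) = f (num 0)"
    using XOR XOR_add[of 0 0] p_gt_1 by (metis add_0 dig_num_0 num_closed order_less_trans zero_less_one)
  then have dig_f0: "(dig (f (num 0)) k + dig (f (num 0)) k) mod p = (dig (f (num 0)) k + 0) mod p" for k
    by (metis add_0_right dig_XOR dig_mod closed num_closed)
  have f0: "f (num 0) = num 0"
  proof (rule dig_eqI)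
    fix k
    have "p dvd dig (f (num 0)) k"
      using dig_f0[of k] unfolding mod_eq_dvd_iff by simp
    then show "dig (f (num 0)) k = dig (num 0) k"
      using dig_bounds[of "f (num 0)" k] zdvd_not_zless[of "dig (f (num 0)) k" p] by force
  qed simp_all
  have single: "f (num (int d * p ^ n)) = num (int d * p ^ n)" if "int d < p" for d n
    using that
  proof (induction d)
    case 0
    then show ?case using f0 by simp
  next
    case (Suc d)
    have "padic_XOR p (num (int d * p ^ n)) (num (p ^ n)) = num (int (Suc d) * p ^ n)"
      using Suc.prems p_gt_1 by (subst XOR_add) (auto simp: dig_num_single algebra_simps)
    then show ?case
      using Suc XOR fixed by (metis num_closed less_trans of_nat_less_iff lessI)
  qed
  have below: "f (num r) = num r" if "0 \<le> r" "r < p ^ n" for r n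
    using that
  proof (induction n arbitrary: r)
    case 0
    then have "r = 0" by simp
    then show ?case using f0 by simp
  next
    case (Suc n)
    define d where "d = r div p ^ n"
    define s where "s = r mod p ^ n"
    have s: "0 \<le> s" "s < p ^ n"
      using p_gt_1 by (simp_all add: s_def)
    have d: "0 \<le> d" "d < p"
      using Suc.prems p_gt_1 by (simp_all add: d_def pos_imp_zdiv_nonneg_iff div_less_if_less_mult_int)
    have "dig (num s) k + dig (num (d * p ^ n)) k < p" for k
      using d s dig_bounds[OF num_closed, of s k] by (simp add: dig_num_single dig_num_eq_0)
    then have "padic_XOR p (num s) (num (d * p ^ n)) = num r"
      using XOR_add[of s "d * p ^ n"] by (simp add: d_def s_def mod_div_mult_eq)
    moreover have "f (num (d * p ^ n)) = num (d * p ^ n)"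
      using single[of "nat d" n] d by simp
    ultimately show ?case
      using XOR Suc.IH[OF s] by (metis num_closed)
  qed
  show ?thesis
  proof (rule identity_if_fixes_num[OF _ x])
    fix r :: int assume "0 \<le> r"
    \<comment> \<open>Any power of \<open>p\<close> exceeding \<open>r\<close> would do.\<close>
    moreover have "r < p ^ nat r"
    proof -
      have "int (nat r) < 2 ^ nat r" by (rule of_nat_less_two_power)
      also have "(2::int) ^ nat r \<le> p ^ nat r" using p_gt_1 by (intro power_mono) auto
      finally show ?thesis by linarith
    qed
    ultimately show "f (num r) = num r" by (rule below)
  qed
qed

subsection \<open>Multiplicative maps\<close>

lemma multiplicative_1:
  assumes mult: "preserves (padic_mult p)"
  shows "f (num 1) = num 1"
proof -
  obtain z where "z \<in> Z" "f z = num 1"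
    using surjE num_closed by blast
  then show ?thesis
    using mult mult_num_1 mult_commute by (metis num_closed closed)
qed

lemma multiplicative_minus_1:
  assumes mult: "preserves (padic_mult p)"
  shows "f (num (-1)) = num (-1)"
proof -
  have "padic_mult p (f (num (-1))) (f (num (-1))) = num 1"
    using mult[rule_format, of "num (-1)" "num (-1)"] multiplicative_1[OF mult]
    by (simp add: num_mult)
  then have "f (num (-1)) = num 1 \<or> f (num (-1)) = num (-1)"
    by (intro square_eq_1) simp_all
  moreover have "num (-1) \<noteq> num 1"
    using dig_num_minus_1[of 1] dig_num_1[of 1] p_gt_1 by (auto simp del: dig_num_minus_1 dig_num_1)
  ultimately show ?thesis
    using inj[of "num (-1)" "num 1"] multiplicative_1[OF mult] by auto
qed

text \<open>All digits of \<open>-1\<close> are \<open>p - 1\<close>, so XOR with \<open>1\<close> replaces the digit \<open>0\<close> by zero and leaves the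
  expansion of \<open>-p\<close>. Since \<open>f\<close> fixes \<open>1\<close> and \<open>-1\<close>, it fixes \<open>-p\<close>, hence \<open>p\<close> and its powers.\<close>

lemma multiplicative_XOR_fixes_power:
  assumes mult: "preserves (padic_mult p)" and XOR: "preserves (padic_XOR p)"
  shows "f (num (p ^ n)) = num (p ^ n)"
proof -
  have "padic_XOR p (num (-1)) (num 1) = num (- p)"
  proof (rule dig_eqI)
    fix k
    show "dig (padic_XOR p (num (- 1)) (num 1)) k = dig (num (- p)) k"
    proof (cases k)
      case 0
      have "dig (num (- p)) 0 = 0"
        by (simp add: padic_digit_def padic_of_int_def)
      then show ?thesis using 0 by simp
    next
      case (Suc j)
      have "(- p) mod p ^ Suc (Suc j) = p * ((-1) mod p ^ Suc j)"
        by (simp add: mult_mod_right)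
      then have "dig (num (- p)) (Suc j) = dig (num (-1)) j"
        using p_gt_1 by (simp add: padic_digit_def padic_of_int_def)
      then show ?thesis using Suc p_gt_1 by (simp add: zmod_minus1)
    qed
  qed simp_all
  then have "f (num (- p)) = num (- p)"
    using XOR[rule_format, of "num (-1)" "num 1"] multiplicative_1[OF mult] multiplicative_minus_1[OF mult]
    by simp
  then have fp: "f (num p) = num p"
    using mult[rule_format, of "num (-1)" "num (- p)"] multiplicative_minus_1[OF mult]
    by (simp add: num_mult)
  show ?thesis
  proof (induction n)
    case 0
    show ?case using multiplicative_1[OF mult] by simp
  next
    case (Suc n)
    then show ?case
      using mult[rule_format, of "num p" "num (p ^ n)"] fp by (simp add: num_mult)
  qed
qed

text \<open>As \<open>f\<close> fixes \<open>p ^ n\<close>, and AND with \<open>p ^ n\<close> extracts the digit at position \<open>n\<close>, the map \<open>f\<close> acts on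
  all digits by the same function \<open>\<phi>\<close>. The digits of \<open>-1\<close> show that \<open>\<phi>\<close> fixes \<open>p - 1\<close>. For
  \<open>1 \<le> d < p\<close> the product \<open>d * (p - 1)\<close> has digit \<open>d - 1\<close> at position \<open>1\<close>. The same holds for its
  image \<open>\<phi> d * (p - 1)\<close>, whence \<open>\<phi> (d - 1) = \<phi> d - 1\<close>. With \<open>\<phi> 0 = 0\<close> this determines \<open>\<phi>\<close>.\<close>

lemma multiplicative_AND_identity:
  assumes mult: "preserves (padic_mult p)" and AND: "preserves (padic_AND p)" and x: "x \<in> Z"
  shows "f x = x"
proof -
  define \<phi> where "\<phi> d = dig (f (num d)) 0" for d
  have \<phi>: "0 \<le> \<phi> d" "\<phi> d < p" for d
    by (simp_all add: \<phi>_def dig_bounds)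
  have f_num: "f (num d) = num (\<phi> d)" if "0 \<le> d" "d < p" for d
  proof -
    have "padic_AND p (num d) (num (p ^ 0)) = num d"
      using that by (simp only: AND_num_power dig_num_digit num_closed) simp
    then have "f (num d) = padic_AND p (f (num d)) (num (p ^ 0))"
      using AND[rule_format, of "num d" "num (p ^ 0)"] AND_fixes_power(2)[OF AND, of 0]
      by (simp only: num_closed)
    also have "\<dots> = num (\<phi> d * p ^ 0)"
      by (simp only: AND_num_power \<phi>_def num_closed closed)
    finally show ?thesis by simp
  qed
  have dig_f: "dig (f y) n = \<phi> (dig y n)" if y: "y \<in> Z" for y n
  proof -
    have "num (dig (f y) n * p ^ n) = f (num (dig y n * p ^ n))"
      using AND[rule_format, of y "num (p ^ n)"] AND_fixes_power(2)[OF AND, of n] y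
      by (simp add: AND_num_power)
    also have "\<dots> = num (\<phi> (dig y n) * p ^ n)"
      using mult[rule_format, of "num (dig y n)" "num (p ^ n)"] AND_fixes_power(2)[OF AND, of n]
        f_num[OF dig_bounds[OF y]]
      by (simp add: num_mult)
    finally have "dig (num (dig (f y) n * p ^ n)) n = dig (num (\<phi> (dig y n) * p ^ n)) n"
      by (rule arg_cong)
    then show ?thesis
      by (simp only: dig_num_single[OF dig_bounds[OF closed[OF y]]] dig_num_single[OF \<phi>] refl if_True)
  qed
  have top: "\<phi> (p - 1) = p - 1"
    using dig_f[of "num (-1)" 0] multiplicative_minus_1[OF mult] by simp
  \<comment> \<open>In base \<open>p\<close>, \<open>d * (p - 1)\<close> has the two digits \<open>p - d\<close> and \<open>d - 1\<close>.\<close>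
  have dig_1: "dig (num (d * (p - 1))) 1 = d - 1" if "1 \<le> d" "d < p" for d
  proof -
    have "d * (p - 1) = (p - d) + p * (d - 1)"
      by (simp add: algebra_simps)
    moreover have "d * (p - 1) < p * p"
      using that by (intro mult_strict_mono') auto
    moreover have "0 \<le> d * (p - 1)" using that by simp
    ultimately show ?thesis
      using that by (simp add: padic_digit_def padic_of_int_def)
  qed
  have step: "\<phi> (d - 1) = \<phi> d - 1" if d: "1 \<le> d" "d < p" for d
  proof -
    have "\<phi> d \<noteq> 0"
    proof
      assume "\<phi> d = 0"
      then have "f (num d) = f (num 0)"
        using f_num[of d] d AND_fixes_power(1)[OF AND] by simp
      then have "num d = num 0" by (rule inj[OF num_closed num_closed])
      then show False
        using dig_num_digit[of d 0] d by simp
    qed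
    then have "1 \<le> \<phi> d" using \<phi>(1)[of d] by linarith
    have "f (num (d * (p - 1))) = num (\<phi> d * (p - 1))"
      using mult[rule_format, of "num d" "num (p - 1)"] f_num[of d] f_num[of "p - 1"] top d
      by (simp add: num_mult)
    then show ?thesis
      using dig_f[of "num (d * (p - 1))" 1] dig_1[OF d] dig_1[OF \<open>1 \<le> \<phi> d\<close> \<phi>(2)] by simp
  qed
  have \<phi>_id: "\<phi> (int d) = int d" if "int d < p" for d
    using that
  proof (induction d)
    case 0
    show ?case using AND_fixes_power(1)[OF AND] by (simp add: \<phi>_def)
  next
    case (Suc d)
    then show ?case using step[of "int (Suc d)"] by simp
  qed
  show ?thesis
    using x dig_f[OF x] \<phi>_id[of "nat (dig x k)" for k] dig_bounds[OF x]
    by (intro dig_eqI) simp_all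
qed

end

section \<open>Triviality of the automorphism groups\<close>

text \<open>Closure of the operations makes the identity an automorphism: as an extensional function it is
  the identity only on the carrier. The congruence relations enter as equality of residues, and the group laws
  come for free since the carrier is the trivial subgroup of the group of all bijections.\<close>

lemma trivial_padic_AutI:
  assumes p: "p > 1"
    and op1: "\<And>x y. x \<in> padic_ints p \<Longrightarrow> y \<in> padic_ints p \<Longrightarrow> op1 x y \<in> padic_ints p"
    and op2: "\<And>x y. x \<in> padic_ints p \<Longrightarrow> y \<in> padic_ints p \<Longrightarrow> op2 x y \<in> padic_ints p"
    and id: "\<And>f x. \<lbrakk>bij_betw f (padic_ints p) (padic_ints p);
        \<And>x y k. \<lbrakk>x \<in> padic_ints p; y \<in> padic_ints p; x k = y k\<rbrakk> \<Longrightarrow> f x k = f y k;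
        \<forall>x\<in>padic_ints p. \<forall>y\<in>padic_ints p. f (op1 x y) = op1 (f x) (f y);
        \<forall>x\<in>padic_ints p. \<forall>y\<in>padic_ints p. f (op2 x y) = op2 (f x) (f y);
        x \<in> padic_ints p\<rbrakk> \<Longrightarrow> f x = x"
  shows "trivial_group (padic_Aut p op1 op2)"
proof -
  let ?S = "padic_ints p" and ?G = "padic_Aut p op1 op2"
  have id_Bij: "(\<lambda>x\<in>?S. x) \<in> Bij ?S" by (rule id_Bij)
  have carrier: "carrier ?G = {\<lambda>x\<in>?S. x}"
  proof
    show "carrier ?G \<subseteq> {\<lambda>x\<in>?S. x}"
    proof
      fix f assume f: "f \<in> carrier ?G"
      then have Bij: "f \<in> Bij ?S" by (simp add: padic_Aut_def)
      then have bij: "bij_betw f ?S ?S" and ext: "f \<in> extensional ?S"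
        by (auto simp: Bij_def)
      have cong: "f x k = f y k" if "x \<in> ?S" "y \<in> ?S" "x k = y k" for x y k
      proof (cases "k = 0")
        case True
        have "f x \<in> ?S" "f y \<in> ?S" using that bij by (auto simp: bij_betw_def)
        then show ?thesis using padic_intsD(1,2)[of "f x" p 0] padic_intsD(1,2)[of "f y" p 0] True by simp
      next
        case False
        have "f x \<in> ?S" "f y \<in> ?S" using that bij by (auto simp: bij_betw_def)
        moreover have "padic_cong p k x y" using that p by (simp add: padic_cong_iff)
        then have "padic_cong p k (f x) (f y)"
          using f that False by (simp add: padic_Aut_def Suc_le_eq)
        ultimately show ?thesis using p by (simp add: padic_cong_iff)
      qed
      have "f x = x" if "x \<in> ?S" for x
      proof (rule id[OF bij _ _ _ that])
        show "\<forall>x\<in>?S. \<forall>y\<in>?S. f (op1 x y) = op1 (f x) (f y)"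
          and "\<forall>x\<in>?S. \<forall>y\<in>?S. f (op2 x y) = op2 (f x) (f y)"
          using f by (simp_all add: padic_Aut_def)
      qed (rule cong)
      then show "f \<in> {\<lambda>x\<in>?S. x}"
        using ext by (auto simp: extensional_def)
    qed
    show "{\<lambda>x\<in>?S. x} \<subseteq> carrier ?G"
      using id_Bij op1 op2 by (simp add: padic_Aut_def)
  qed
  interpret B: group "BijGroup ?S" by (rule group_BijGroup)
  have "{\<one>\<^bsub>BijGroup ?S\<^esub>} = carrier ?G"
    by (simp add: carrier BijGroup_def)
  moreover have "group (BijGroup ?S\<lparr>carrier := {\<one>\<^bsub>BijGroup ?S\<^esub>}\<rparr>)"
    by (rule B.subgroup_imp_group[OF B.triv_subgroup])
  ultimately have "group ?G"
    by (simp add: padic_Aut_def)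
  with carrier show ?thesis
    by (simp add: trivial_group_padic_Aut_iff)
qed

theorem theorem2p5:
  fixes p :: int
  assumes "Factorial_Ring.prime p"
  shows "trivial_group (padic_Aut p (padic_add p) (padic_mult p)) \<and>
    trivial_group (padic_Aut p (padic_add p) (padic_XOR p)) \<and>
    trivial_group (padic_Aut p (padic_add p) (padic_AND p)) \<and>
    trivial_group (padic_Aut p (padic_mult p) (padic_XOR p)) \<and>
    trivial_group (padic_Aut p (padic_mult p) (padic_AND p)) \<and>
    trivial_group (padic_Aut p (padic_XOR p) (padic_AND p))"
proof -
  have p: "p > 1" using assms by (simp add: prime_gt_1_int)
  note closed = padic_add_closed[OF p] padic_mult_closed[OF p] padic_XOR_closed[OF p] padic_AND_closed[OF p]
  have bijection: "padic_bijection p f"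
    if "bij_betw f (padic_ints p) (padic_ints p)"
      "\<And>x y k. \<lbrakk>x \<in> padic_ints p; y \<in> padic_ints p; x k = y k\<rbrakk> \<Longrightarrow> f x k = f y k" for f
    by (intro padic_bijection.intro padic_prime.intro padic_bijection_axioms.intro assms that)
  have "trivial_group (padic_Aut p (padic_add p) (padic_mult p))"
  proof (rule trivial_padic_AutI, goal_cases)
    case (4 f x)
    interpret padic_bijection p f by (rule bijection) (fact 4)+
    show ?case by (rule additive_identity[OF 4(3) multiplicative_1[OF 4(4)] 4(5)])
  qed (simp_all add: p closed)
  moreover have "trivial_group (padic_Aut p (padic_add p) (padic_XOR p))"
  proof (rule trivial_padic_AutI, goal_cases)
    case (4 f x)
    interpret padic_bijection p f by (rule bijection) (fact 4)+
    show ?case by (rule additive_identity[OF 4(3) additive_XOR_unit[OF 4(3,4)] 4(5)])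
  qed (simp_all add: p closed)
  moreover have "trivial_group (padic_Aut p (padic_add p) (padic_AND p))"
  proof (rule trivial_padic_AutI, goal_cases)
    case (4 f x)
    interpret padic_bijection p f by (rule bijection) (fact 4)+
    have "f (num 1) = num 1" using AND_fixes_power(2)[OF 4(4), of 0] by simp
    then show ?case by (rule additive_identity[OF 4(3) _ 4(5)])
  qed (simp_all add: p closed)
  moreover have "trivial_group (padic_Aut p (padic_mult p) (padic_XOR p))"
  proof (rule trivial_padic_AutI, goal_cases)
    case (4 f x)
    interpret padic_bijection p f by (rule bijection) (fact 4)+
    show ?case by (rule XOR_identity[OF 4(4) multiplicative_XOR_fixes_power[OF 4(3,4)] 4(5)])
  qed (simp_all add: p closed)
  moreover have "trivial_group (padic_Aut p (padic_mult p) (padic_AND p))"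
  proof (rule trivial_padic_AutI, goal_cases)
    case (4 f x)
    interpret padic_bijection p f by (rule bijection) (fact 4)+
    show ?case by (rule multiplicative_AND_identity[OF 4(3-5)])
  qed (simp_all add: p closed)
  moreover have "trivial_group (padic_Aut p (padic_XOR p) (padic_AND p))"
  proof (rule trivial_padic_AutI, goal_cases)
    case (4 f x)
    interpret padic_bijection p f by (rule bijection) (fact 4)+
    show ?case by (rule XOR_identity[OF 4(3) AND_fixes_power(2)[OF 4(4)] 4(5)])
  qed (simp_all add: p closed)
  ultimately show ?thesis by blast
qed

end
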